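(* Let $(\mathcal{X},\mathcal{X}')$ be a dual pair of Banach spaces, let $\nu_1,\dots,\nu_M\in\mathcal{X}$ be linearly independent, and let $\mathcal{N}_{\boldsymbol{\nu}}=\mathrm{span}\{\nu_m\}_{m=1}^M\subset\mathcal{X}$. Let $\boldsymbol{\nu}:\mathcal{X}'\to\mathbb{R}^M$ be the linear measurement operator $f\mapsto \boldsymbol{\nu}(f)=(\langle\nu_1,f\rangle,\dots,\langle\nu_M,f\rangle)$ (it is weak$^\ast$ continuous on $\mathcal{X}'$ because $\nu_1,\dots,\nu_M\in\mathcal{X}$). Let $E:\mathbb{R}^M\times\mathbb{R}^M\to\mathbb{R}^+\cup\{+\infty\}$ be a loss functional that is proper, weak lower-semicontinuous and convex in its second argument, and let $\psi:\mathbb{R}^+\to\mathbb{R}^+$ be an arbitrary strictly increasing and convex function. Then, for any fixed $\boldsymbol{y}\in\mathbb{R}^M$, the solution set $$S=\arg\min_{f\in\mathcal{X}'}\; E\big(\boldsymbol{y},\boldsymbol{\nu}(f)\big)+\psi\big(\|f\|_{\mathcal{X}'}\big)$$ is nonempty, convex, and weak$^\ast$-compact. If $E$ is strictly convex (in its second argument), or if it imposes the equality $\boldsymbol{y}=\boldsymbol{\nu}(f)$, then there exists a weight vector $\boldsymbol{a}=(a_m)\in\mathbb{R}^M$ such that any solution $f_0\in S\subset\mathcal{X}'$ is a $(\mathcal{X}',\mathcal{X})$-conjugate of the common element $$\nu_0=\sum_{m=1}^M a_m\nu_m\in\mathcal{N}_{\boldsymbol{\nu}}\subset\mathcal{X};$$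 that is, $S\subseteq\mathcal{J}_{\mathcal{X}}(\nu_0)$. Moreover, if $\mathcal{X}$ is strictly convex and $f\mapsto\psi(\|f\|_{\mathcal{X}'})$ is strictly convex, then the solution is unique with $f_0=\mathrm{J}_{\mathcal{X}}\{\nu_0\}\in\mathcal{X}'$ (the Banach conjugate of $\nu_0$). In particular, if $\mathcal{X}$ is a Hilbert space, then $f_0=\sum_{m=1}^M a_m\nu_m^\ast$, where $\nu_m^\ast$ is the Riesz conjugate of $\nu_m$.
   Context: All spaces are real, and $\mathbb{R}^+=[0,\infty)$. A dual pair $(\mathcal{X},\mathcal{X}')$ of Banach spaces consists of a Banach space $\mathcal{X}$ and its continuous dual $\mathcal{X}'$, equipped with the dual norm $\|u\|_{\mathcal{X}'}=\sup_{v\in\mathcal{X}\setminus\{0\}}\langle u,v\rangle/\|v\|_{\mathcal{X}}$. For $\nu\in\mathcal{X}$ and $f\in\mathcal{X}'$, $\langle\nu,f\rangle=\langle f,\nu\rangle=f(\nu)$ denotes the duality pairing. A normed space is strictly convex if, for all $v_1\neq v_2$ of norm $1$ and all $\lambda\in(0,1)$, $\|\lambda v_1+(1-\lambda)v_2\|<1$. Elements $v^\ast\in\mathcal{X}'$ and $v\in\mathcal{X}$ form a conjugate pair if (1) $\|v^\ast\|_{\mathcal{X}'}=\|v\|_{\mathcal{X}}$ and (2) $\langle v^\ast,v\rangle=\|v^\ast\|_{\mathcal{X}'}\|v\|_{\mathcal{X}}$; $v^\ast$ is then called a ($(\mathcal{X}',\mathcal{X})$-)conjugate of $v$. The duality mapping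 is the set-valued map $$\mathcal{J}_{\mathcal{X}}(v)=\{v^\ast\in\mathcal{X}':\ \|v^\ast\|_{\mathcal{X}'}=\|v\|_{\mathcal{X}},\ \langle v^\ast,v\rangle=\|v^\ast\|_{\mathcal{X}'}\|v\|_{\mathcal{X}}\},$$ which is always nonempty. When it is single-valued (for instance, when $\mathcal{X}'$ is strictly convex), the duality operator $\mathrm{J}_{\mathcal{X}}:\mathcal{X}\to\mathcal{X}'$ is defined by $\mathcal{J}_{\mathcal{X}}(v)=\{\mathrm{J}_{\mathcal{X}}\{v\}\}$. When $\mathcal{X}$ is a Hilbert space, $\mathrm{J}_{\mathcal{X}}$ is the inverse of the Riesz map $\mathcal{X}'\to\mathcal{X}$, and $\nu^\ast=\mathrm{J}_{\mathcal{X}}\{\nu\}$ is the Riesz conjugate of $\nu$. "$E$ imposes the equality $\boldsymbol{y}=\boldsymbol{\nu}(f)$" means that $E$ is the barrier functional $E(\boldsymbol{y},\boldsymbol{z})=0$ if $\boldsymbol{y}=\boldsymbol{z}$ and $+\infty$ otherwise. *)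

theory Defs
  imports "HOL-Analysis.Analysis"
begin

text \<open>The continuous dual of a Banach space \<open>'a\<close> is \<open>'a \<Rightarrow>\<^sub>L real\<close> with its operator norm.
  For real-valued operators the strong operator topology is the topology of pointwise
  convergence on \<open>'a\<close>, that is, the weak* topology of the dual.\<close>

abbreviation weak_star_topology :: "('a::real_normed_vector \<Rightarrow>\<^sub>L real) topology" where
  "weak_star_topology \<equiv> strong_operator_topology"

definition weak_topology :: "'a::real_normed_vector topology" where
  "weak_topology = pullback_topology UNIV (\<lambda>x (l :: 'a \<Rightarrow>\<^sub>L real). blinfun_apply l x) euclidean"

definition weakly_lsc :: "('a::real_normed_vector \<Rightarrow> ennreal) \<Rightarrow> bool" where
  "weakly_lsc g \<longleftrightarrow> (\<forall>c. closedin weak_topology {x. g x \<le> c})"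

definition proper_fun :: "('a \<Rightarrow> ennreal) \<Rightarrow> bool" where
  "proper_fun g \<longleftrightarrow> (\<exists>x. g x < \<infinity>)"

definition convex_fun :: "('a::real_vector \<Rightarrow> ennreal) \<Rightarrow> bool" where
  "convex_fun g \<longleftrightarrow> (\<forall>x y. \<forall>t\<in>{0<..<1}.
     g (t *\<^sub>R x + (1 - t) *\<^sub>R y) \<le> ennreal t * g x + ennreal (1 - t) * g y)"

text \<open>Strictness is required only between points of the effective domain, the usual convention
  for extended-valued functions; if one of the two values is infinite, the convexity
  inequality holds trivially.\<close>

definition strictly_convex_fun :: "('a::real_vector \<Rightarrow> ennreal) \<Rightarrow> bool" where
  "strictly_convex_fun g \<longleftrightarrow> (\<forall>x y. \<forall>t\<in>{0<..<1}. x \<noteq> y \<and> g x < \<infinity> \<and> g y < \<infinity> \<longrightarrow>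
     g (t *\<^sub>R x + (1 - t) *\<^sub>R y) < ennreal t * g x + ennreal (1 - t) * g y)"

definition strictly_convex_space :: "'a::real_normed_vector itself \<Rightarrow> bool" where
  "strictly_convex_space _ \<longleftrightarrow> (\<forall>(v\<^sub>1::'a) v\<^sub>2. \<forall>t\<in>{0<..<1}.
     v\<^sub>1 \<noteq> v\<^sub>2 \<and> norm v\<^sub>1 = 1 \<and> norm v\<^sub>2 = 1 \<longrightarrow> norm (t *\<^sub>R v\<^sub>1 + (1 - t) *\<^sub>R v\<^sub>2) < 1)"

definition conjugate_pair :: "('a::real_normed_vector \<Rightarrow>\<^sub>L real) \<Rightarrow> 'a \<Rightarrow> bool" where
  "conjugate_pair f v \<longleftrightarrow> norm f = norm v \<and> blinfun_apply f v = norm f * norm v"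

definition duality_map :: "'a::real_normed_vector \<Rightarrow> ('a \<Rightarrow>\<^sub>L real) set" where
  "duality_map v = {f. conjugate_pair f v}"

text \<open>Meaningful only where the duality mapping is single-valued.\<close>

definition duality_op :: "'a::real_normed_vector \<Rightarrow> 'a \<Rightarrow>\<^sub>L real" where
  "duality_op v = the_elem (duality_map v)"

text \<open>A Banach space is a Hilbert space iff its norm is induced by an inner product. Since
  being a Hilbert space is a condition on the given norm, the inner product is a parameter here
  and not the operation of the class \<open>real_inner\<close>. Positivity follows from the last conjunct.\<close>

definition induces_norm :: "('a::real_normed_vector \<Rightarrow> 'a \<Rightarrow> real) \<Rightarrow> bool" where
  "induces_norm ip \<longleftrightarrow>
     bilinear ip \<and> (\<forall>x y. ip x y = ip y x) \<and> (\<forall>x. ip x x = (norm x)\<^sup>2)"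

definition riesz_conjugate :: "('a::real_normed_vector \<Rightarrow> 'a \<Rightarrow> real) \<Rightarrow> 'a \<Rightarrow> 'a \<Rightarrow>\<^sub>L real" where
  "riesz_conjugate ip v = Blinfun (ip v)"

definition measurement ::
    "('m::finite \<Rightarrow> 'a::real_normed_vector) \<Rightarrow> ('a \<Rightarrow>\<^sub>L real) \<Rightarrow> real ^ 'm" where
  "measurement \<nu> f = (\<chi> m. blinfun_apply f (\<nu> m))"

definition solution_set ::
    "('m::finite \<Rightarrow> 'a::real_normed_vector) \<Rightarrow> (real ^ 'm \<Rightarrow> real ^ 'm \<Rightarrow> ennreal) \<Rightarrow>
     (real \<Rightarrow> real) \<Rightarrow> real ^ 'm \<Rightarrow> ('a \<Rightarrow>\<^sub>L real) set" where
  "solution_set \<nu> E \<psi> y =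
     {f. is_arg_min (\<lambda>f. E y (measurement \<nu> f) + ennreal (\<psi> (norm f))) (\<lambda>_. True) f}"

definition imposes_equality :: "('b \<Rightarrow> 'b \<Rightarrow> ennreal) \<Rightarrow> bool" where
  "imposes_equality E \<longleftrightarrow> (\<forall>y z. E y z = (if y = z then 0 else \<infinity>))"

lemma continuous_map_measurement:
  "continuous_map weak_star_topology euclidean (measurement \<nu>)"
  using strong_operator_topology_continuous_evaluation
  by (auto simp: measurement_def [abs_def] continuous_map_atin intro!: tendsto_vec_lambda)

lemma induces_norm_Cauchy_Schwarz:
  assumes "induces_norm ip"
  shows "\<bar>ip v w\<bar> \<le> norm v * norm w"
proof -
  have bil: "bilinear ip" and sym: "\<And>x y. ip x y = ip y x" and sq: "\<And>x. ip x x = (norm x)\<^sup>2"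
    using assms by (auto simp: induces_norm_def)
  have *: "0 \<le> norm v * norm w * (norm v * norm w + s * ip v w)" if "s = 1 \<or> s = -1" for s
  proof -
    let ?x = "norm w *\<^sub>R v + (s * norm v) *\<^sub>R w"
    have "ip ?x ?x = 2 * (norm v * norm w * (norm v * norm w + s * ip v w))"
      using that
      by (auto simp: bilinear_ladd[OF bil] bilinear_radd[OF bil] bilinear_lmul[OF bil] bilinear_rmul[OF bil]
          sym[of w v] sq[of v] sq[of w] power2_eq_square algebra_simps)
    moreover have "0 \<le> ip ?x ?x" unfolding sq[of ?x] by simp
    ultimately show ?thesis by linarith
  qed
  show ?thesis
  proof (cases "v = 0 \<or> w = 0")
    case True
    then show ?thesis using bilinear_lzero[OF bil] bilinear_rzero[OF bil] by auto
  next
    case False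
    then have "0 < norm v * norm w" by simp
    with *[of 1] *[of "-1"] show ?thesis by (simp add: zero_le_mult_iff)
  qed
qed

lemma riesz_conjugate_apply:
  assumes "induces_norm ip"
  shows "blinfun_apply (riesz_conjugate ip v) w = ip v w"
proof -
  have "linear (ip v)" using assms by (simp add: induces_norm_def bilinear_def)
  then have "bounded_linear (ip v)"
    using induces_norm_Cauchy_Schwarz[OF assms]
    by (auto simp: bounded_linear_def bounded_linear_axioms_def intro!: exI[of _ "norm v"]
        simp: mult.commute[of _ "norm v"])
  then show ?thesis by (simp add: riesz_conjugate_def bounded_linear_Blinfun_apply)
qed

text \<open>On a Hilbert space the duality operator is the inverse of the Riesz map.\<close>

lemma duality_map_Hilbert:
  assumes "induces_norm ip"
  shows "duality_map v = {riesz_conjugate ip v}"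
proof -
  have bil: "bilinear ip" and sym: "\<And>x y. ip x y = ip y x" and sq: "\<And>x. ip x x = (norm x)\<^sup>2"
    using assms by (auto simp: induces_norm_def)
  note ap = riesz_conjugate_apply[OF assms]
  have le: "norm (riesz_conjugate ip v) \<le> norm v"
    by (rule norm_blinfun_bound) (auto simp: ap induces_norm_Cauchy_Schwarz[OF assms])
  have "norm v * norm v \<le> norm (riesz_conjugate ip v) * norm v"
    using norm_blinfun[of "riesz_conjugate ip v" v] by (simp add: ap sq power2_eq_square)
  then have ge: "norm v \<le> norm (riesz_conjugate ip v)"
    by (cases "v = 0") auto
  have mem: "riesz_conjugate ip v \<in> duality_map v"
    using le ge by (simp add: duality_map_def conjugate_pair_def ap sq power2_eq_square)
  have uniq: "f = riesz_conjugate ip v" if f: "f \<in> duality_map v" for f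
  proof (rule blinfun_eqI)
    fix w
    have nf: "norm f = norm v" and fv: "blinfun_apply f v = (norm v)\<^sup>2"
      using f by (auto simp: duality_map_def conjugate_pair_def power2_eq_square)
    define F where "F = (\<lambda>w. blinfun_apply f w - ip v w)"
    have bound: "\<bar>blinfun_apply f x\<bar> \<le> norm v * norm x" for x
      using norm_blinfun[of f x] by (simp add: nf)
    have "F w = 0"
    proof (cases "v = 0")
      case True
      then show ?thesis using bound[of w] bilinear_lzero[OF bil] by (simp add: F_def)
    next
      case False
      define u where "u = w - (ip v w / (norm v)\<^sup>2) *\<^sub>R v"
      have ipu: "ip v u = 0"
        using False by (simp add: u_def bilinear_rsub[OF bil] bilinear_rmul[OF bil] sq)
      have Fu: "blinfun_apply f u = F w"
        using False by (simp add: u_def F_def blinfun.diff_right blinfun.scaleR_right fv)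
      have key: "2 * t * (norm v)\<^sup>2 * F w + t\<^sup>2 * (F w)\<^sup>2 \<le> t\<^sup>2 * (norm v)\<^sup>2 * (norm u)\<^sup>2" for t
      proof -
        have "(norm (v + t *\<^sub>R u))\<^sup>2 = (norm v)\<^sup>2 + t\<^sup>2 * (norm u)\<^sup>2"
          unfolding sq[of "v + t *\<^sub>R u", symmetric]
          by (simp add: bilinear_ladd[OF bil] bilinear_radd[OF bil] bilinear_lmul[OF bil] bilinear_rmul[OF bil]
              sym[of u v] ipu sq[of v] sq[of u] power2_eq_square)
        moreover have "((norm v)\<^sup>2 + t * F w)\<^sup>2 \<le> (norm v * norm (v + t *\<^sub>R u))\<^sup>2"
          using power_mono[OF bound[of "v + t *\<^sub>R u"], of 2]
          by (simp add: blinfun.add_right blinfun.scaleR_right fv Fu)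
        ultimately show ?thesis
          by (simp add: power_mult_distrib algebra_simps power2_eq_square)
      qed
      show ?thesis
      proof (rule ccontr)
        assume F: "F w \<noteq> 0"
        then have u: "u \<noteq> 0" using Fu by auto
        let ?s = "1 / (norm u)\<^sup>2"
        have "2 * ?s * (norm v)\<^sup>2 * (F w)\<^sup>2 + (?s * F w)\<^sup>2 * (F w)\<^sup>2
              \<le> ?s * (norm v)\<^sup>2 * (F w)\<^sup>2"
          using key[of "?s * F w"] u by (simp add: power2_eq_square field_simps)
        moreover have "0 < ?s * (norm v)\<^sup>2 * (F w)\<^sup>2" using F u False by simp
        moreover have "0 \<le> (?s * F w)\<^sup>2 * (F w)\<^sup>2" by simp
        ultimately show False by linarith
      qed
    qed
    then show "blinfun_apply f w = blinfun_apply (riesz_conjugate ip v) w"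
      by (simp add: F_def ap)
  qed
  show ?thesis using mem uniq by blast
qed

end

theory Submission
  imports Defs
begin

text \<open>
  Existence: the sublevel sets of the objective are weak* closed and, since \<open>\<psi>\<close> is coercive, norm
  bounded, so Banach-Alaoglu applies. For the conjugacy, strict convexity forces all solutions to
  have the same measurements \<open>z\<close>, and a solution then has minimal norm among the functionals with
  measurements \<open>z\<close>. Such functionals all restrict to one functional \<open>L\<close> on the span of the \<open>\<nu> m\<close>, and
  by Hahn-Banach their minimal norm is the norm of \<open>L\<close>, which is attained because the span is
  finite-dimensional. A vector attaining it, scaled to norm \<open>\<parallel>L\<parallel>\<close>, is the common element \<open>\<nu>\<^sub>0\<close>.
\<close>

section \<open>The Hahn-Banach theorem\<close>

text \<open>Homogeneity is asked only as an inequality for positive factors, which is easy to check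
  for infima. The inverse factor gives equality.\<close>

definition sublinear :: "('a::real_vector \<Rightarrow> real) \<Rightarrow> bool" where
  "sublinear q \<longleftrightarrow> (\<forall>x y. q (x + y) \<le> q x + q y) \<and> (\<forall>c>0. \<forall>x. q (c *\<^sub>R x) \<le> c * q x)"

lemma sublinear_add: "sublinear q \<Longrightarrow> q (x + y) \<le> q x + q y"
  by (simp add: sublinear_def)

lemma sublinear_scale_le: "sublinear q \<Longrightarrow> c > 0 \<Longrightarrow> q (c *\<^sub>R x) \<le> c * q x"
  by (simp add: sublinear_def)

lemma sublinear_zero:
  assumes "sublinear q" shows "q 0 = 0"
  using sublinear_scale_le[OF assms, of 2 0] sublinear_scale_le[OF assms, of "1/2" 0] by simp

lemma sublinear_scale:
  assumes "sublinear q" "c > 0"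
  shows "q (c *\<^sub>R x) = c * q x"
proof (rule antisym)
  show "c * q x \<le> q (c *\<^sub>R x)"
    using sublinear_scale_le[OF assms(1), of "inverse c" "c *\<^sub>R x"] assms(2)
    by (simp add: field_simps)
qed (rule sublinear_scale_le[OF assms])

lemma sublinear_minus_le:
  assumes "sublinear q"
  shows "- q (- x) \<le> q x"
  using sublinear_add[OF assms, of x "- x"] sublinear_zero[OF assms] by simp

text \<open>Supplies the chain bounds for Zorn's lemma. The infimum is finite because
  \<open>q \<le> p\<close> gives \<open>- p (- x) \<le> - q (- x) \<le> q x\<close>. Subadditivity
  uses the chain: the smaller of \<open>q\<close> and \<open>q'\<close> bounds the mixed sum
  \<open>q x + q' y\<close> from below.\<close>

lemma sublinear_chain_Inf:
  assumes ne: "C \<noteq> {}"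
    and sub: "\<And>q. q \<in> C \<Longrightarrow> sublinear q \<and> q \<le> p"
    and chain: "\<And>q q'. q \<in> C \<Longrightarrow> q' \<in> C \<Longrightarrow> q \<le> q' \<or> q' \<le> q"
  defines "u \<equiv> \<lambda>x. INF q\<in>C. q x"
  shows "sublinear u" and "\<And>q. q \<in> C \<Longrightarrow> u \<le> q"
proof -
  have bdd: "bdd_below ((\<lambda>q. q x) ` C)" for x
  proof (rule bdd_belowI2)
    fix q assume "q \<in> C"
    then show "- p (- x) \<le> q x"
      using sub[of q] sublinear_minus_le[of q x] by (auto simp: le_fun_def dest: spec[of _ "- x"])
  qed
  have low: "u x \<le> q x" if "q \<in> C" for q x
    unfolding u_def using bdd that by (rule cINF_lower)
  then show "u \<le> q" if "q \<in> C" for q using that by (simp add: le_fun_def)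
  have great: "k \<le> u x" if "\<And>q. q \<in> C \<Longrightarrow> k \<le> q x" for k x
    unfolding u_def using ne that by (rule cINF_greatest)
  have "u (x + y) \<le> u x + u y" for x y
  proof -
    have "u (x + y) \<le> q x + q' y" if q: "q \<in> C" "q' \<in> C" for q q'
    proof -
      obtain r where r: "r \<in> C" "r \<le> q" "r \<le> q'" using chain[OF q] q by blast
      have "u (x + y) \<le> r x + r y"
        using low[OF r(1)] sublinear_add[of r x y] sub[OF r(1)] by (meson order_trans)
      also have "\<dots> \<le> q x + q' y" using r by (intro add_mono) (auto simp: le_fun_def)
      finally show ?thesis .
    qed
    \<comment> \<open>The two infima are taken one at a time: first over \<open>q\<close> with
      \<open>q'\<close> fixed, then over \<open>q'\<close>. The same device recurs in the later
      subadditivity proofs.\<close>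
    then have "u (x + y) - q' y \<le> u x" if "q' \<in> C" for q'
      using that by (intro great) (simp add: diff_le_eq)
    then have "u (x + y) - u x \<le> u y" by (intro great) (simp add: algebra_simps)
    then show ?thesis by simp
  qed
  moreover have "u (c *\<^sub>R x) \<le> c * u x" if c: "c > 0" for c x
  proof -
    have "u (c *\<^sub>R x) / c \<le> q x" if "q \<in> C" for q
      using low[OF that, of "c *\<^sub>R x"] sublinear_scale_le[of q c x] sub[OF that] c
      by (simp add: divide_le_eq mult.commute)
    then have "u (c *\<^sub>R x) / c \<le> u x"
      by (rule great)
    then show ?thesis using c by (simp add: divide_le_eq mult.commute)
  qed
  ultimately show "sublinear u" by (simp add: sublinear_def)
qed

text \<open>Minimality forces additivity. Additivity makes \<open>q\<close> odd, which extends
  homogeneity from positive to negative factors.\<close>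

lemma minimal_sublinear_linear:
  assumes q: "sublinear q"
    and minimal: "\<And>r. sublinear r \<Longrightarrow> r \<le> q \<Longrightarrow> r = q"
  shows "linear q"
proof -
  have add: "q (x + y) = q x + q y" for x y
  proof -
    \<comment> \<open>\<open>r\<close> is sublinear and \<open>r \<le> q\<close>, so \<open>r = q\<close>; then \<open>t = 1\<close> gives superadditivity of \<open>q\<close>.\<close>
    define r where "r = (\<lambda>x. INF t\<in>{0..}. q (x + t *\<^sub>R y) - t * q y)"
    have scale: "q (t *\<^sub>R x) = t * q x" if "t \<ge> 0" for t x
      using that sublinear_scale[OF q] sublinear_zero[OF q] by (cases "t = 0") auto
    \<comment> \<open>Splitting \<open>t *\<^sub>R y\<close> as
      \<open>- x + (x + t *\<^sub>R y)\<close> bounds \<open>t * q y\<close>, so the infimum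
      defining \<open>r\<close> is finite.\<close>
    have bdd: "bdd_below ((\<lambda>t. q (x + t *\<^sub>R y) - t * q y) ` {0..})" for x
    proof (rule bdd_belowI2)
      fix t :: real assume "t \<in> {0..}"
      then show "- q (- x) \<le> q (x + t *\<^sub>R y) - t * q y"
        using sublinear_add[OF q, of "- x" "x + t *\<^sub>R y"] scale[of t y] by simp
    qed
    have low: "r x \<le> q (x + t *\<^sub>R y) - t * q y" if "t \<ge> 0" for t x
      unfolding r_def using bdd[of x] that by (intro cINF_lower) auto
    have great: "k \<le> r x" if "\<And>t. t \<ge> 0 \<Longrightarrow> k \<le> q (x + t *\<^sub>R y) - t * q y" for k x
      unfolding r_def using that by (intro cINF_greatest) auto
    have "r (x + z) \<le> r x + r z" for x z
    proof -
      \<comment> \<open>Parameters \<open>s\<close> for \<open>x\<close> and \<open>t\<close> for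
        \<open>z\<close> combine to the admissible parameter \<open>s + t\<close> for
        \<open>x + z\<close>.\<close>
      have "r (x + z) - (q (z + t *\<^sub>R y) - t * q y) \<le> q (x + s *\<^sub>R y) - s * q y"
        if "s \<ge> 0" "t \<ge> 0" for s t
        using low[of "s + t" "x + z"] that sublinear_add[OF q, of "x + s *\<^sub>R y" "z + t *\<^sub>R y"]
        by (simp add: algebra_simps)
      then have "r (x + z) - (q (z + t *\<^sub>R y) - t * q y) \<le> r x" if "t \<ge> 0" for t
        using that by (intro great)
      then have "r (x + z) - r x \<le> r z" by (intro great) (simp add: algebra_simps)
      then show ?thesis by simp
    qed
    moreover have "r (c *\<^sub>R x) \<le> c * r x" if c: "c > 0" for c x
    proof -
      have "r (c *\<^sub>R x) / c \<le> q (x + t *\<^sub>R y) - t * q y" if "t \<ge> 0" for t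
        using low[of "c * t" "c *\<^sub>R x"] c that sublinear_scale[OF q c, of "x + t *\<^sub>R y"]
        by (simp add: pos_divide_le_eq scaleR_add_right right_diff_distrib left_diff_distrib mult_ac)
      then have "r (c *\<^sub>R x) / c \<le> r x"
        by (rule great)
      then show ?thesis using c by (simp add: divide_le_eq mult.commute)
    qed
    ultimately have "sublinear r" by (simp add: sublinear_def)
    moreover have "r \<le> q" using low[of 0] by (simp add: le_fun_def)
    ultimately have "r = q" by (rule minimal)
    then have "q x + q y \<le> q (x + y)" using low[of 1 x] by simp
    with sublinear_add[OF q, of x y] show ?thesis by simp
  qed
  have neg: "q (- x) = - q x" for x using add[of x "- x"] sublinear_zero[OF q] by simp
  have "q (c *\<^sub>R x) = c * q x" for c x
  proof (cases c "0::real" rule: linorder_cases)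
    case less
    then show ?thesis using sublinear_scale[OF q, of "- c" x] neg[of "c *\<^sub>R x"] by simp
  next
    case greater
    then show ?thesis by (rule sublinear_scale[OF q])
  qed (simp add: sublinear_zero[OF q])
  with add show ?thesis by (simp add: linear_iff)
qed

text \<open>Zorn's lemma is applied with the order reversed, so upper bounds of chains are infima
  and a maximal element is a minimal sublinear functional. The empty chain is bounded by
  \<open>p\<close> itself.\<close>

lemma sublinear_dominates_linear:
  assumes p: "sublinear p"
  shows "\<exists>f. linear f \<and> f \<le> p"
proof -
  let ?A = "{q. sublinear q \<and> q \<le> p}"
  have "\<exists>m\<in>?A. \<forall>q\<in>?A. m \<ge> q \<longrightarrow> q = m"
  proof (rule predicate_Zorn)
    show "partial_order_on ?A (relation_of (\<ge>) ?A)"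
      by (rule partial_order_on_relation_ofI) auto
    fix C assume "C \<in> Chains (relation_of (\<ge>) ?A)"
    then have C: "\<And>q. q \<in> C \<Longrightarrow> sublinear q \<and> q \<le> p"
      "\<And>q q'. q \<in> C \<Longrightarrow> q' \<in> C \<Longrightarrow> q \<le> q' \<or> q' \<le> q"
      by (auto simp: Chains_def relation_of_def)
    show "\<exists>u\<in>?A. \<forall>q\<in>C. q \<ge> u"
    proof (cases "C = {}")
      case False
      then obtain q where "q \<in> C" by blast
      then have "q \<le> p" and "(\<lambda>x. INF q\<in>C. q x) \<le> q"
        using C(1) sublinear_chain_Inf(2)[OF False C] by auto
      with sublinear_chain_Inf[OF False C] show ?thesis
        by (intro bexI[of _ "\<lambda>x. INF q\<in>C. q x"]) auto
    qed (use p in auto)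
  qed
  then obtain q where q: "sublinear q" "q \<le> p"
    and "\<And>r. sublinear r \<Longrightarrow> r \<le> p \<Longrightarrow> r \<le> q \<Longrightarrow> r = q"
    by blast
  then have "linear q" by (intro minimal_sublinear_linear) (auto intro: order_trans)
  with q show ?thesis by blast
qed

text \<open>The one-sided bound on \<open>L\<close> suffices because \<open>N\<close> is closed
  under negation. The norm version comes from the sublinear version through a suitable dominating
  functional.\<close>

theorem Hahn_Banach_norm:
  fixes L :: "'a::real_normed_vector \<Rightarrow> real"
  assumes L: "linear L" and N: "subspace N"
    and bound: "\<And>n. n \<in> N \<Longrightarrow> L n \<le> K * norm n" and K: "0 \<le> K"
  shows "\<exists>f::'a \<Rightarrow>\<^sub>L real. norm f \<le> K \<and> (\<forall>n\<in>N. blinfun_apply f n = L n)"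
proof -
  \<comment> \<open>\<open>p\<close> is dominated by \<open>K * norm\<close> everywhere and by \<open>L\<close> on \<open>N\<close>, so any linear \<open>f \<le> p\<close> is the extension.\<close>
  define p where "p = (\<lambda>x. INF n\<in>N. K * norm (x - n) + L n)"
  have ne: "N \<noteq> {}" using N by (auto simp: subspace_def)
  have bdd: "bdd_below ((\<lambda>n. K * norm (x - n) + L n) ` N)" for x
  proof (rule bdd_belowI2)
    fix n assume "n \<in> N"
    then have "L (- n) \<le> K * norm n"
      using bound[of "- n"] N by (simp add: subspace_neg)
    moreover have "K * norm n \<le> K * norm (x - n) + K * norm x"
      using norm_triangle_sub[of n x] K
      by (metis (no_types) add.commute distrib_left mult_left_mono norm_minus_commute)
    ultimately show "- (K * norm x) \<le> K * norm (x - n) + L n"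
      using linear_neg[OF L, of n] by simp
  qed
  have low: "p x \<le> K * norm (x - n) + L n" if "n \<in> N" for x n
    unfolding p_def using bdd that by (rule cINF_lower)
  have great: "k \<le> p x" if "\<And>n. n \<in> N \<Longrightarrow> k \<le> K * norm (x - n) + L n" for k x
    unfolding p_def using ne that by (rule cINF_greatest)
  have "p (x + y) \<le> p x + p y" for x y
  proof -
    have "p (x + y) - (K * norm (y - n) + L n) \<le> K * norm (x - m) + L m"
      if mn: "m \<in> N" "n \<in> N" for m n
    proof -
      have "norm (x + y - (m + n)) \<le> norm (x - m) + norm (y - n)"
        using norm_triangle_ineq[of "x - m" "y - n"] by (simp add: algebra_simps)
      then have "K * norm (x + y - (m + n)) \<le> K * norm (x - m) + K * norm (y - n)"
        using K by (metis distrib_left mult_left_mono)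
      then show ?thesis
        using low[of "m + n" "x + y"] mn N linear_add[OF L, of m n] by (simp add: subspace_add)
    qed
    then have "p (x + y) - (K * norm (y - n) + L n) \<le> p x" if "n \<in> N" for n
      using that by (intro great)
    then have "p (x + y) - p x \<le> p y" by (intro great) (simp add: algebra_simps)
    then show ?thesis by simp
  qed
  moreover have "p (c *\<^sub>R x) \<le> c * p x" if c: "c > 0" for c x
  proof -
    have "p (c *\<^sub>R x) / c \<le> K * norm (x - n) + L n" if "n \<in> N" for n
    proof -
      have "norm (c *\<^sub>R x - c *\<^sub>R n) = c * norm (x - n)"
        using c by (simp flip: scaleR_diff_right)
      then show ?thesis
        using low[of "c *\<^sub>R n" "c *\<^sub>R x"] N c that linear_scale[OF L, of c n]
        by (simp add: divide_le_eq subspace_scale algebra_simps)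
    qed
    then have "p (c *\<^sub>R x) / c \<le> p x"
      by (rule great)
    then show ?thesis using c by (simp add: divide_le_eq mult.commute)
  qed
  ultimately have "sublinear p" by (simp add: sublinear_def)
  then obtain f where f: "linear f" and fp: "\<And>x. f x \<le> p x"
    using sublinear_dominates_linear by (metis le_funD)
  \<comment> \<open>The choice \<open>n = 0\<close> in the infimum gives the norm bound; the choice
    \<open>n = x\<close> below gives \<open>f \<le> L\<close> on \<open>N\<close>, and negation
    turns this into equality.\<close>
  have fK: "f x \<le> K * norm x" for x
    using fp[of x] low[of 0 x] N linear_0[OF L] by (simp add: subspace_0)
  have abs: "\<bar>f x\<bar> \<le> K * norm x" for x
    using fK[of x] fK[of "- x"] linear_neg[OF f, of x] by simp
  have "bounded_linear f"
    using f abs by (auto simp: bounded_linear_def bounded_linear_axioms_def mult.commute intro!: exI[of _ K])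
  then have ap: "blinfun_apply (Blinfun f) = f" by (rule bounded_linear_Blinfun_apply)
  have fL: "f n \<le> L n" if "n \<in> N" for n
    using fp[of n] low[OF that, of n] by simp
  have "f n = L n" if "n \<in> N" for n
    using fL[OF that] fL[of "- n"] that N linear_neg[OF f, of n] linear_neg[OF L, of n]
    by (simp add: subspace_neg)
  moreover have "norm (Blinfun f) \<le> K"
    using abs K by (intro norm_blinfun_bound) (auto simp: ap)
  ultimately show ?thesis using ap by auto
qed

section \<open>Conjugates and minimal-norm interpolation\<close>

lemma duality_map_nonempty: "duality_map (v :: 'a::real_normed_vector) \<noteq> {}"
proof (cases "v = 0")
  case True
  then show ?thesis by (auto simp: duality_map_def conjugate_pair_def intro!: exI[of _ 0])
next
  case False
  \<comment> \<open>The functional \<open>c *\<^sub>R v \<mapsto> c * (norm v)\<^sup>2\<close> on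
    the line through \<open>v\<close> has norm \<open>norm v\<close> there; its Hahn-Banach
    extension is a conjugate.\<close>
  then have "independent {v}" by simp
  then obtain L where L: "linear L" "L v = (norm v)\<^sup>2"
    using linear_independent_extend[of "{v}" "\<lambda>_. (norm v)\<^sup>2"] by auto
  have "L n \<le> norm v * norm n" if span: "n \<in> span {v}" for n
  proof -
    obtain c where n: "n = c *\<^sub>R v" using span by (auto simp: span_singleton)
    have "c * (norm v)\<^sup>2 \<le> \<bar>c\<bar> * (norm v)\<^sup>2" by (intro mult_right_mono) auto
    then show ?thesis using L by (simp add: n linear_scale power2_eq_square mult_ac)
  qed
  then obtain f :: "'a \<Rightarrow>\<^sub>L real" where f: "norm f \<le> norm v" "blinfun_apply f v = (norm v)\<^sup>2"
    using Hahn_Banach_norm[OF L(1) subspace_span, of "{v}" "norm v"] L(2) span_base by fastforce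
  have "norm v * norm v \<le> norm f * norm v"
    using norm_blinfun[of f v] f(2) by (simp add: power2_eq_square)
  then have "norm f = norm v" using f(1) False by (simp add: antisym)
  with f show ?thesis by (auto simp: duality_map_def conjugate_pair_def power2_eq_square)
qed

text \<open>The vector \<open>b\<close> depends on \<open>z\<close> alone, which is what makes the
  conjugate element common to all solutions. The conclusion compares an arbitrary \<open>g\<close>
  with \<open>f\<close> because minimality of a solution yields just such a norm comparison.\<close>

lemma minimal_norm_interpolant:
  fixes \<nu> :: "'m::finite \<Rightarrow> 'a::real_normed_vector" and z :: "real ^ 'm"
  assumes inj: "inj \<nu>" and indep: "independent (range \<nu>)"
  obtains b :: "real ^ 'm" and f where "measurement \<nu> f = z"
    and "\<And>g. measurement \<nu> g = z \<Longrightarrow> norm g \<le> norm f \<Longrightarrow> g \<in> duality_map (\<Sum>m\<in>UNIV. b $ m *\<^sub>R \<nu> m)"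
proof -
  define T where "T = (\<lambda>a :: real ^ 'm. \<Sum>m\<in>UNIV. a $ m *\<^sub>R \<nu> m)"
  have T: "linear T"
    by (simp add: T_def linear_iff scaleR_add_left sum.distrib scaleR_sum_right)
  \<comment> \<open>Injectivity of \<open>T\<close>. Independence concerns the set
    \<open>range \<nu>\<close>, so coefficients are reindexed by vectors through
    \<open>inv \<nu>\<close>.\<close>
  have T0: "a = 0" if "T a = 0" for a
  proof -
    have "(\<Sum>v\<in>range \<nu>. a $ (inv \<nu> v) *\<^sub>R v) = 0"
      using that inj by (simp add: T_def sum.reindex)
    then have "a $ (inv \<nu> v) = 0" if "v \<in> range \<nu>" for v
      using independentD[OF indep, of "range \<nu>" "\<lambda>v. a $ (inv \<nu> v)"] that by auto
    from this[OF rangeI] show ?thesis using inj by (simp add: vec_eq_iff)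
  qed
  obtain L where L: "linear L" and L\<nu>: "\<And>m. L (\<nu> m) = z $ m"
    using linear_independent_extend[OF indep, of "\<lambda>v. z $ (inv \<nu> v)"] inj by auto
  have LT: "L (T a) = z \<bullet> a" for a
    by (simp add: T_def linear_sum[OF L] linear_scale[OF L] L\<nu> inner_vec_def mult.commute)
  have span: "\<exists>a. n = T a" if n: "n \<in> span (range \<nu>)" for n
  proof -
    obtain u where "n = (\<Sum>v\<in>range \<nu>. u v *\<^sub>R v)" using n by (auto simp: span_finite)
    then have "n = T (\<chi> m. u (\<nu> m))" using inj by (simp add: T_def sum.reindex)
    then show ?thesis ..
  qed
  \<comment> \<open>The quotient is \<open>L (T a) / norm (T a)\<close>, so its maximum is the norm
    of \<open>L\<close> on the span. The coefficient sphere is compact, and injectivity of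
    \<open>T\<close> keeps the denominator nonzero.\<close>
  have "\<exists>a\<in>sphere 0 1. \<forall>a'\<in>sphere 0 1. (z \<bullet> a') / norm (T a') \<le> (z \<bullet> a) / norm (T a)"
  proof (rule continuous_attains_sup)
    show "sphere (0 :: real ^ 'm) 1 \<noteq> {}" by simp
    have "bounded_linear T" using T by (simp add: linear_conv_bounded_linear)
    then show "continuous_on (sphere 0 1) (\<lambda>a. (z \<bullet> a) / norm (T a))"
      using T0 by (intro continuous_intros linear_continuous_on) force+
  qed simp
  then obtain a where a: "norm a = 1"
    and max: "\<And>a'. norm a' = 1 \<Longrightarrow> (z \<bullet> a') / norm (T a') \<le> (z \<bullet> a) / norm (T a)" by auto
  define K where "K = (z \<bullet> a) / norm (T a)"
  have Ta: "norm (T a) > 0" using a T0[of a] by auto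
  have LK: "L n \<le> K * norm n" if "n \<in> span (range \<nu>)" for n
  proof -
    obtain a' where n: "n = T a'" using span[OF \<open>n \<in> _\<close>] by blast
    show ?thesis
    proof (cases "a' = 0")
      case True
      then show ?thesis by (simp add: n linear_0[OF T] linear_0[OF L])
    next
      case False
      then have "norm (T a') > 0" using T0[of a'] by auto
      with False show ?thesis
        using max[of "a' /\<^sub>R norm a'"]
        by (simp add: n LT linear_scale[OF T] K_def field_simps)
    qed
  qed
  \<comment> \<open>Passing from \<open>a\<close> to \<open>- a\<close> negates the quotient, so its
    maximum cannot be negative.\<close>
  have K: "K \<ge> 0" using max[of "- a"] a by (simp add: linear_neg[OF T] K_def)
  obtain f where fK: "norm f \<le> K" and fL: "\<And>n. n \<in> span (range \<nu>) \<Longrightarrow> blinfun_apply f n = L n"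
    using Hahn_Banach_norm[OF L subspace_span LK K] by blast
  have meas: "measurement \<nu> f = z"
    by (simp add: measurement_def vec_eq_iff fL span_base L\<nu>)
  \<comment> \<open>The scaling gives \<open>T b\<close> norm \<open>K\<close>, and hence
    \<open>L (T b) = K * K\<close>: exactly the two conditions of a conjugate pair for a functional
    of norm \<open>K\<close>.\<close>
  define b where "b = (K / norm (T a)) *\<^sub>R a"
  have norm_Tb: "norm (T b) = K" using Ta K by (simp add: b_def linear_scale[OF T])
  have zb: "z \<bullet> b = K * K" using Ta by (simp add: b_def K_def)
  show ?thesis
  proof (rule that[OF meas])
    fix g assume g: "measurement \<nu> g = z" and gf: "norm g \<le> norm f"
    have "blinfun_apply g (\<nu> m) = z $ m" for m using g by (auto simp: measurement_def)
    then have gTb: "blinfun_apply g (T b) = K * K"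
      by (simp add: zb[symmetric] T_def blinfun.sum_right blinfun.scaleR_right inner_vec_def mult.commute)
    then have "K * K \<le> norm g * K" using norm_blinfun[of g "T b"] norm_Tb by simp
    then have "norm g = K" using gf fK K by (cases "K = 0") auto
    then have "g \<in> duality_map (T b)"
      using gTb norm_Tb by (simp add: duality_map_def conjugate_pair_def)
    then show "g \<in> duality_map (\<Sum>m\<in>UNIV. b $ m *\<^sub>R \<nu> m)"
      by (simp add: T_def)
  qed
qed

section \<open>Weak* compactness and minimizers\<close>

text \<open>A norm bound is a family of pointwise bounds, each closed because evaluations are weak*
  continuous.\<close>

lemma closedin_weak_star_cball:
  "closedin weak_star_topology {f :: 'a::real_normed_vector \<Rightarrow>\<^sub>L real. norm f \<le> r}"
proof (cases "r \<ge> 0")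
  case True
  have "{f :: 'a \<Rightarrow>\<^sub>L real. norm f \<le> r} = (\<Inter>x. {f. blinfun_apply f x \<in> cball (0::real) (r * norm x)})"
  proof (intro equalityI subsetI)
    fix f :: "'a \<Rightarrow>\<^sub>L real" assume "f \<in> {f. norm f \<le> r}"
    then have "\<bar>blinfun_apply f x\<bar> \<le> r * norm x" for x
      using norm_blinfun[of f x] mult_right_mono[of "norm f" r "norm x"] by simp
    then show "f \<in> (\<Inter>x. {f. blinfun_apply f x \<in> cball (0::real) (r * norm x)})"
      by (simp add:)
  next
    fix f :: "'a \<Rightarrow>\<^sub>L real" assume "f \<in> (\<Inter>x. {f. blinfun_apply f x \<in> cball (0::real) (r * norm x)})"
    then show "f \<in> {f. norm f \<le> r}"
      using True by (auto intro!: norm_blinfun_bound simp:)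
  qed
  moreover have "closedin weak_star_topology {f :: 'a \<Rightarrow>\<^sub>L real. blinfun_apply f x \<in> cball (0::real) b}" for x b
    using closedin_continuous_map_preimage[OF strong_operator_topology_continuous_evaluation, of "cball (0::real) b" x]
    by (simp add: strong_operator_topology_topspace)
  ultimately show ?thesis by auto
next
  case False
  then have "{f :: 'a \<Rightarrow>\<^sub>L real. norm f \<le> r} = {}" using order_trans[OF norm_ge_zero] by blast
  then show ?thesis by simp
qed

text \<open>By Tychonoff the product \<open>?P\<close> of intervals is compact, and linearity is a
  closed condition in it. The ball lies in the continuous image of the resulting compact set, and it
  is closed.\<close>

theorem Banach_Alaoglu:
  "compactin weak_star_topology {f :: 'a::real_normed_vector \<Rightarrow>\<^sub>L real. norm f \<le> r}"
proof (cases "r \<ge> 0")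
  case True
  let ?B = "{f :: 'a \<Rightarrow>\<^sub>L real. norm f \<le> r}"
  let ?P = "PiE UNIV (\<lambda>x::'a. cball (0::real) (r * norm x))"
  let ?Lin = "{g :: 'a \<Rightarrow> real. (\<forall>x y. g (x + y) = g x + g y) \<and> (\<forall>c x. g (c *\<^sub>R x) = c * g x)}"
  have P: "compactin euclidean ?P"
    using compactin_PiE[of "\<lambda>_. euclideanreal" UNIV "\<lambda>x::'a. cball (0::real) (r * norm x)"]
    by (simp add: euclidean_product_topology)
  have eq: "?Lin = (\<Inter>x y. {g. g (x + y) = g x + g y}) \<inter> (\<Inter>c x. {g. g (c *\<^sub>R x) = c * g x})"
    by auto
  have "closed ?Lin"
    unfolding eq by (intro closed_Int closed_INT ballI closed_Collect_eq continuous_intros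
        continuous_on_product_coordinates)
  then have K: "compactin euclidean (?Lin \<inter> ?P)"
    using compact_Int_closedin[OF P] by (simp only: closed_closedin[symmetric] Int_commute[of ?Lin])
  have bl: "bounded_linear g" if "g \<in> ?Lin \<inter> ?P" for g
    using that by (auto simp: bounded_linear_def bounded_linear_axioms_def linear_iff mult.commute
        PiE_def Pi_def intro!: exI[of _ r])
  have ap: "blinfun_apply (Blinfun g) = g" if "g \<in> ?Lin \<inter> ?P" for g
    using bl[OF that] by (rule bounded_linear_Blinfun_apply)
  \<comment> \<open>Both topologies are those of pointwise convergence. The restriction to
    \<open>?Lin \<inter> ?P\<close> matters because \<open>Blinfun g\<close> evaluates like
    \<open>g\<close> only for bounded linear \<open>g\<close>.\<close>
  have "continuous_map (top_of_set (?Lin \<inter> ?P)) weak_star_topology Blinfun"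
    unfolding continuous_on_strong_operator_topo_iff_coordinatewise
  proof
    fix x
    have "continuous_on (?Lin \<inter> ?P) (\<lambda>g. g x)"
      by (rule continuous_on_subset[OF continuous_on_product_coordinates]) simp
    then have "continuous_on (?Lin \<inter> ?P) (\<lambda>g. blinfun_apply (Blinfun g) x)"
      by (rule continuous_on_eq) (simp only: ap)
    then show "continuous_map (top_of_set (?Lin \<inter> ?P)) euclidean (\<lambda>g. blinfun_apply (Blinfun g) x)"
      by simp
  qed
  then have "compactin weak_star_topology (Blinfun ` (?Lin \<inter> ?P))"
    using K by (intro image_compactin) (auto simp: compactin_subtopology)
  moreover have "?B \<subseteq> Blinfun ` (?Lin \<inter> ?P)"
  proof
    fix f assume f: "f \<in> ?B"
    have "\<bar>blinfun_apply f x\<bar> \<le> r * norm x" for x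
      using f norm_blinfun[of f x] mult_right_mono[of "norm f" r "norm x"] by simp
    then have "blinfun_apply f \<in> ?Lin \<inter> ?P"
      by (simp add: PiE_iff blinfun.add_right blinfun.scaleR_right)
    then show "f \<in> Blinfun ` (?Lin \<inter> ?P)"
      by (metis (no_types, lifting) blinfun_apply_inverse image_eqI)
  qed
  ultimately show ?thesis using closedin_weak_star_cball by (rule closed_compactin)
next
  case False
  then have "{f :: 'a \<Rightarrow>\<^sub>L real. norm f \<le> r} = {}" using order_trans[OF norm_ge_zero] by blast
  then show ?thesis by simp
qed

section \<open>Closed sublevel sets and existence of minimizers\<close>

lemma closedin_sublevel_add:
  fixes g h :: "'b \<Rightarrow> ennreal"
  assumes X: "topspace X = UNIV"
    and g: "\<And>c. closedin X {x. g x \<le> c}" and h: "\<And>c. closedin X {x. h x \<le> c}"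
  shows "closedin X {x. g x + h x \<le> c}"
proof (cases c)
  case (real r)
  \<comment> \<open>The sum exceeds \<open>r\<close> exactly when some \<open>q\<close> has
    \<open>g x > q\<close> and \<open>h x > r - q\<close>. Excluding each \<open>q\<close> is a
    union of two closed conditions, so the sublevel set is an intersection of closed sets.\<close>
  have "g x + h x \<le> c \<longleftrightarrow> g x \<le> c \<and> h x \<le> c \<and> (\<forall>q. g x \<le> ennreal q \<or> h x \<le> ennreal (r - q))" for x
  proof (cases "g x \<le> c \<and> h x \<le> c")
    case True
    then obtain s t where s: "g x = ennreal s" "s \<ge> 0" and t: "h x = ennreal t" "t \<ge> 0"
      using real by (metis ennreal_cases ennreal_less_top leD)
    have "s + t \<le> r" if "\<And>q. s \<le> max q 0 \<or> t \<le> max (r - q) 0"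
    proof (rule ccontr)
      assume "\<not> s + t \<le> r"
      then obtain q where "r - t < q" "q < s" using dense[of "r - t" s] by auto
      \<comment> \<open>These bounds make \<open>q\<close> and \<open>r - q\<close> nonnegative, so
        the truncation of \<open>ennreal\<close> at 0 is harmless.\<close>
      moreover have "s \<le> r" "t \<le> r" using True s t real by (auto simp: ennreal_le_iff)
      ultimately show False using that[of q] by (auto simp: max_def split: if_splits)
    qed
    moreover have "s \<le> max q 0 \<or> t \<le> max (r - q) 0" if "s + t \<le> r" for q using that by auto
    moreover have "ennreal u \<le> ennreal v \<longleftrightarrow> u \<le> max v 0" if "u \<ge> 0" for u v
      using that by (auto simp: ennreal_le_iff2)
    ultimately show ?thesis
      using True s t real by (auto simp: ennreal_plus[symmetric] simp del: ennreal_plus)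
  next
    case False
    moreover have "g x \<le> c \<and> h x \<le> c" if "g x + h x \<le> c"
      using that order_trans[of "g x" "g x + h x" c] order_trans[of "h x" "g x + h x" c] by simp
    ultimately show ?thesis by blast
  qed
  then have "{x. g x + h x \<le> c} = {x. g x \<le> c} \<inter> {x. h x \<le> c} \<inter>
      (\<Inter>q. {x. g x \<le> ennreal q} \<union> {x. h x \<le> ennreal (r - q)})" by auto
  also have "closedin X \<dots>"
    using g h by (intro closedin_Int closedin_INT closedin_Un) auto
  finally show ?thesis .
qed (use closedin_topspace[of X] X in auto)

text \<open>The minimizers are the common points of all sublevel sets at attained values. Finitely
  many of these always meet, at a minimizer over a finite set, so the finite intersection property
  applies.\<close>

lemma compactin_arg_min:
  fixes g :: "'b \<Rightarrow> 'c::linorder"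
  assumes closed: "\<And>c. closedin X {x. g x \<le> c}" and compact: "compactin X {x. g x \<le> g x0}"
  shows "{x. is_arg_min g (\<lambda>_. True) x} \<noteq> {}"
    and "compactin X {x. is_arg_min g (\<lambda>_. True) x}"
proof -
  have eq: "{x. is_arg_min g (\<lambda>_. True) x} = {x. g x \<le> g x0} \<inter> (\<Inter>y. {x. g x \<le> g y})"
    by (auto simp: is_arg_min_linorder)
  have "{x. g x \<le> g x0} \<inter> \<Inter>\<F> \<noteq> {}" if \<F>: "finite \<F>" "\<F> \<subseteq> range (\<lambda>y. {x. g x \<le> g y})" for \<F>
  proof -
    obtain A where A: "finite A" "\<F> = (\<lambda>y. {x. g x \<le> g y}) ` A"
      using finite_subset_image[OF \<F>] by blast
    obtain x where "is_arg_min g (\<lambda>x. x \<in> insert x0 A) x"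
      using ex_is_arg_min_if_finite[of "insert x0 A" g] A(1) by blast
    then have "x \<in> {x. g x \<le> g x0} \<inter> \<Inter>\<F>" using A by (auto simp: is_arg_min_linorder)
    then show ?thesis by blast
  qed
  then show "{x. is_arg_min g (\<lambda>_. True) x} \<noteq> {}"
    unfolding eq using compact[unfolded compactin_fip] closed
    by (elim conjE allE[of _ "range (\<lambda>y. {x. g x \<le> g y})"]) auto
  show "compactin X {x. is_arg_min g (\<lambda>_. True) x}"
    unfolding eq by (rule compact_Int_closedin[OF compact]) (use closed in auto)
qed

lemma ennreal_weighted_mean:
  assumes "0 < t" "t < 1"
  shows "ennreal t * a + ennreal (1 - t) * a = a"
proof -
  have "ennreal t + ennreal (1 - t) = 1"
    using assms by (subst ennreal_plus[symmetric]) auto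
  then show ?thesis by (metis distrib_right mult_1)
qed

section \<open>Convexity of the objective and of its minimizer set\<close>

lemma convex_fun_add:
  assumes "convex_fun g" "convex_fun h"
  shows "convex_fun (\<lambda>x. g x + h x)"
  unfolding convex_fun_def
proof (intro allI ballI)
  fix x y and t :: real assume "t \<in> {0<..<1}"
  then have "g (t *\<^sub>R x + (1 - t) *\<^sub>R y) + h (t *\<^sub>R x + (1 - t) *\<^sub>R y)
      \<le> (ennreal t * g x + ennreal (1 - t) * g y) + (ennreal t * h x + ennreal (1 - t) * h y)"
    using assms by (intro add_mono) (auto simp: convex_fun_def)
  then show "g (t *\<^sub>R x + (1 - t) *\<^sub>R y) + h (t *\<^sub>R x + (1 - t) *\<^sub>R y)
      \<le> ennreal t * (g x + h x) + ennreal (1 - t) * (g y + h y)"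
    by (simp add: distrib_left add_ac)
qed

lemma convex_fun_compose_linear:
  assumes "linear T" "convex_fun g"
  shows "convex_fun (\<lambda>x. g (T x))"
  using assms by (simp add: convex_fun_def linear_add[OF assms(1)] linear_scale[OF assms(1)])

lemma convex_arg_min:
  assumes g: "convex_fun g"
  shows "convex {x. is_arg_min g (\<lambda>_. True) x}"
proof -
  have "is_arg_min g (\<lambda>_. True) (t *\<^sub>R x + (1 - t) *\<^sub>R y)"
    if xy: "is_arg_min g (\<lambda>_. True) x" "is_arg_min g (\<lambda>_. True) y" and t: "t \<in> {0..1}" for x y t
  proof (cases "t = 0 \<or> t = 1")
    case False
    then have "g (t *\<^sub>R x + (1 - t) *\<^sub>R y) \<le> ennreal t * g x + ennreal (1 - t) * g y"
      using g t by (simp add: convex_fun_def)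
    also have "g y = g x" using xy by (simp add: is_arg_min_linorder antisym)
    finally have "g (t *\<^sub>R x + (1 - t) *\<^sub>R y) \<le> g x"
      using t False by (simp add: ennreal_weighted_mean)
    with xy(1) show ?thesis by (auto simp: is_arg_min_linorder intro: order_trans)
  qed (use xy in auto)
  then show ?thesis
    by (auto simp: convex_def algebra_simps dest!: eq_diff_eq[THEN iffD2])
qed

text \<open>Between two minimizers neither summand can drop strictly below its chord while the other
  stays convex, since the total would fall below the minimum. Finiteness keeps the inequality strict
  after adding \<open>h\<close>. It serves with the loss as \<open>g\<close> and with the
  regularizer as \<open>g\<close>.\<close>

lemma arg_min_no_strict_decrease:
  assumes x: "is_arg_min (\<lambda>x. g x + h x) (\<lambda>_. True) x" and y: "is_arg_min (\<lambda>x. g x + h x) (\<lambda>_. True) y"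
    and finite: "g x + h x < \<infinity>"
    and t: "0 < t" "t < 1"
    and h: "h (t *\<^sub>R x + (1 - t) *\<^sub>R y) \<le> ennreal t * h x + ennreal (1 - t) * h y"
  shows "\<not> g (t *\<^sub>R x + (1 - t) *\<^sub>R y) < ennreal t * g x + ennreal (1 - t) * g y"
proof
  let ?m = "t *\<^sub>R x + (1 - t) *\<^sub>R y"
  assume g: "g ?m < ennreal t * g x + ennreal (1 - t) * g y"
  have eq: "g y + h y = g x + h x" using x y by (simp add: is_arg_min_linorder antisym)
  then have "g y + h y < \<infinity>" using finite by simp
  with finite have "h x < \<infinity>" "h y < \<infinity>" by auto
  then have fin: "ennreal t * h x + ennreal (1 - t) * h y < \<infinity>"
    by (simp add: ennreal_mult_less_top)
  have "g ?m + h ?m \<le> g ?m + (ennreal t * h x + ennreal (1 - t) * h y)"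
    using h by (rule add_left_mono)
  also have "\<dots> < (ennreal t * g x + ennreal (1 - t) * g y) + (ennreal t * h x + ennreal (1 - t) * h y)"
    using g fin by (simp add: ennreal_add_left_cancel_less add.commute less_top[symmetric])
  also have "\<dots> = ennreal t * (g x + h x) + ennreal (1 - t) * (g y + h y)"
    by (simp add: distrib_left add_ac)
  also have "\<dots> = g x + h x" using t by (simp add: eq ennreal_weighted_mean)
  finally show False using x by (auto simp: is_arg_min_linorder leD)
qed

section \<open>Weak* closedness of the data term\<close>

lemma linear_measurement: "linear (measurement \<nu>)"
  by (simp add: linear_iff measurement_def vec_eq_iff blinfun.add_left blinfun.scaleR_left)

text \<open>Bounded functionals are norm continuous, so the identity is continuous from the norm
  topology to the weak one.\<close>

lemma weakly_closed_imp_closed: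
  assumes "closedin weak_topology S"
  shows "closed (S :: 'a::real_normed_vector set)"
proof -
  have "continuous_map euclidean weak_topology (\<lambda>x::'a. x)"
    unfolding weak_topology_def
  proof (rule continuous_map_pullback')
    have "continuous_on UNIV (\<lambda>(x::'a) (l :: 'a \<Rightarrow>\<^sub>L real). blinfun_apply l x)"
      by (intro continuous_on_coordinatewise_then_product continuous_intros)
    then show "continuous_map euclidean euclidean ((\<lambda>(x::'a) (l :: 'a \<Rightarrow>\<^sub>L real). blinfun_apply l x) \<circ> (\<lambda>x. x))"
      by (simp add: comp_def)
  qed auto
  then have "closedin euclidean {x \<in> topspace euclidean. x \<in> S}"
    using assms by (rule closedin_continuous_map_preimage)
  then show ?thesis by (simp add: closed_closedin[symmetric])
qed

lemma closedin_measurement_sublevel: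
  assumes "weakly_lsc g"
  shows "closedin weak_star_topology {f. g (measurement \<nu> f) \<le> c}"
proof -
  have "closedin weak_topology {z. g z \<le> c}"
    using assms by (simp add: weakly_lsc_def)
  then have "closedin euclidean {z. g z \<le> c}"
    by (simp add: weakly_closed_imp_closed)
  from closedin_continuous_map_preimage[OF continuous_map_measurement this, of \<nu>]
  show ?thesis by (simp add: strong_operator_topology_topspace)
qed

section \<open>The norm regularizer\<close>

locale regularizer =
  fixes \<psi> :: "real \<Rightarrow> real"
  assumes nonneg: "t \<ge> 0 \<Longrightarrow> 0 \<le> \<psi> t"
    and strict_mono: "strict_mono_on {0..} \<psi>"
    and convex: "convex_on {0..} \<psi>"
begin

lemma less_iff: "s \<ge> 0 \<Longrightarrow> t \<ge> 0 \<Longrightarrow> \<psi> s < \<psi> t \<longleftrightarrow> s < t"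
  using strict_mono_on_less[OF strict_mono] by simp

lemma le_iff: "s \<ge> 0 \<Longrightarrow> t \<ge> 0 \<Longrightarrow> \<psi> s \<le> \<psi> t \<longleftrightarrow> s \<le> t"
  using less_iff[of t s] by linarith

text \<open>Convexity gives continuity on the open half-line. This serves to recover a ball of
  radius \<open>norm f\<close> from strictly smaller radii.\<close>

lemma left_lsc:
  assumes "r > 0" "c < \<psi> r"
  obtains t where "0 \<le> t" "t < r" "c < \<psi> t"
proof -
  have "convex_on {0<..} \<psi>"
    by (rule convex_on_subset[OF convex]) auto
  then have "continuous_on {0<..} \<psi>" by (intro convex_on_continuous) auto
  then have "isCont \<psi> r" using \<open>r > 0\<close> by (simp add: continuous_on_eq_continuous_at)
  then have "(\<psi> \<longlongrightarrow> \<psi> r) (at_left r)" by (simp add: continuous_at filterlim_at_split)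
  then have "\<forall>\<^sub>F t in at_left r. c < \<psi> t" using \<open>c < \<psi> r\<close> by (rule order_tendstoD)
  moreover have "\<forall>\<^sub>F t in at_left r. t \<in> {0<..<r}" by (rule eventually_at_leftI[OF _ \<open>r > 0\<close>])
  ultimately have "\<forall>\<^sub>F t in at_left r. c < \<psi> t \<and> t \<in> {0<..<r}" by (rule eventually_conj)
  then obtain t where "c < \<psi> t \<and> t \<in> {0<..<r}"
    using eventually_happens[of _ "at_left r"] by force
  then show thesis using that[of t] by auto
qed

lemma closedin_norm_sublevel:
  "closedin weak_star_topology {f :: 'a::real_normed_vector \<Rightarrow>\<^sub>L real. ennreal (\<psi> (norm f)) \<le> c}"
proof -
  have UNIV: "closedin weak_star_topology (UNIV :: ('a \<Rightarrow>\<^sub>L real) set)"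
    using closedin_topspace[of "weak_star_topology :: ('a \<Rightarrow>\<^sub>L real) topology"]
    by (simp add: strong_operator_topology_topspace)
  show ?thesis
  proof (cases c)
    case (real r)
    show ?thesis
    proof (cases "\<psi> 0 \<le> r")
      case True
      \<comment> \<open>The sublevel set is the intersection of the balls whose radius
        \<open>t\<close> satisfies \<open>\<psi> t > r\<close>. The case assumption makes
        \<open>norm f\<close> positive where \<open>left_lsc\<close> is applied.\<close>
      have "\<psi> (norm f) \<le> r \<longleftrightarrow> (\<forall>t. t \<ge> 0 \<and> r < \<psi> t \<longrightarrow> norm f \<le> t)" for f :: "'a \<Rightarrow>\<^sub>L real"
      proof
        assume r: "\<forall>t. t \<ge> 0 \<and> r < \<psi> t \<longrightarrow> norm f \<le> t"
        show "\<psi> (norm f) \<le> r"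
        proof (rule ccontr)
          assume "\<not> \<psi> (norm f) \<le> r"
          moreover from this have "norm f > 0" using True by (cases "norm f = 0") auto
          ultimately obtain t where "0 \<le> t" "t < norm f" "r < \<psi> t" using left_lsc[of "norm f" r] by auto
          with r show False by auto
        qed
      next
        assume r: "\<psi> (norm f) \<le> r"
        show "\<forall>t. t \<ge> 0 \<and> r < \<psi> t \<longrightarrow> norm f \<le> t"
          using r by (auto simp flip: le_iff)
      qed
      then have "{f :: 'a \<Rightarrow>\<^sub>L real. ennreal (\<psi> (norm f)) \<le> c} =
          (\<Inter>t. {f. t \<ge> 0 \<and> r < \<psi> t \<longrightarrow> norm f \<le> t})"
        using real by (auto simp: ennreal_le_iff)
      moreover have "closedin weak_star_topology {f :: 'a \<Rightarrow>\<^sub>L real. t \<ge> 0 \<and> r < \<psi> t \<longrightarrow> norm f \<le> t}" for t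
        using closedin_weak_star_cball[where 'a='a, of t] UNIV
        by (cases "t \<ge> 0 \<and> r < \<psi> t") auto
      ultimately show ?thesis by auto
    next
      case False
      then have "\<not> \<psi> (norm f) \<le> r" for f :: "'a \<Rightarrow>\<^sub>L real"
        using le_iff[of 0 "norm f"] by auto
      then show ?thesis using real by (simp add: ennreal_le_iff)
    qed
  next
    case top
    then show ?thesis using UNIV by simp
  qed
qed

text \<open>Beyond 1, convexity puts \<open>\<psi>\<close> above the line through its values at 0
  and 1, whose slope \<open>d\<close> is positive by strict monotonicity.\<close>

lemma coercive: "\<exists>R. \<forall>t\<ge>0. \<psi> t \<le> r \<longrightarrow> t \<le> R"
proof (intro exI allI impI)
  define d where "d = \<psi> 1 - \<psi> 0"
  have d: "d > 0" using less_iff[of 0 1] by (simp add: d_def)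
  fix t :: real assume t: "t \<ge> 0" "\<psi> t \<le> r"
  show "t \<le> max 1 (r / d)"
  proof (cases "t \<le> 1")
    case False
    \<comment> \<open>The convex combination of 0 and \<open>t\<close> equals 1.\<close>
    then have "\<psi> ((1 - 1/t) *\<^sub>R 0 + (1/t) *\<^sub>R t) \<le> (1 - 1/t) * \<psi> 0 + (1/t) * \<psi> t"
      using convex_onD[OF convex, of "1/t" 0 t] by simp
    then have "t * d \<le> \<psi> t - \<psi> 0" using False by (simp add: d_def field_simps)
    also have "\<dots> \<le> r" using t nonneg[of 0] by simp
    finally have "t \<le> r / d" using d by (simp add: pos_le_divide_eq)
    then show ?thesis by simp
  qed simp
qed

lemma convex_fun_norm: "convex_fun (\<lambda>x :: 'b::real_normed_vector. ennreal (\<psi> (norm x)))"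
  unfolding convex_fun_def
proof (intro allI ballI)
  fix x y :: 'b and t :: real assume t: "t \<in> {0<..<1}"
  have "norm (t *\<^sub>R x + (1 - t) *\<^sub>R y) \<le> t * norm x + (1 - t) * norm y"
    using norm_triangle_ineq[of "t *\<^sub>R x" "(1 - t) *\<^sub>R y"] t by simp
  then have "\<psi> (norm (t *\<^sub>R x + (1 - t) *\<^sub>R y)) \<le> \<psi> (t * norm x + (1 - t) * norm y)"
    using t by (subst le_iff) auto
  also have "\<dots> \<le> t * \<psi> (norm x) + (1 - t) * \<psi> (norm y)"
    using convex_onD[OF convex, of "1 - t" "norm x" "norm y"] t by simp
  finally show "ennreal (\<psi> (norm (t *\<^sub>R x + (1 - t) *\<^sub>R y)))
      \<le> ennreal t * ennreal (\<psi> (norm x)) + ennreal (1 - t) * ennreal (\<psi> (norm y))"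
    using t nonneg[of "norm x"] nonneg[of "norm y"]
    by (simp add: ennreal_mult[symmetric] ennreal_plus[symmetric] del: ennreal_plus)
qed

text \<open>Strict monotonicity of \<open>\<psi>\<close> transfers the strict inequality from the
  regularizer back to the norm.\<close>

lemma strictly_convex_norm_midpoint:
  assumes strict: "strictly_convex_fun (\<lambda>x :: 'b::real_normed_vector. ennreal (\<psi> (norm x)))"
    and "x \<noteq> y" "norm (x::'b) = norm y"
  shows "norm ((1/2) *\<^sub>R x + (1/2) *\<^sub>R y) < norm y"
proof -
  have "ennreal (\<psi> (norm ((1/2) *\<^sub>R x + (1 - 1/2) *\<^sub>R y))) <
      ennreal (1/2) * ennreal (\<psi> (norm x)) + ennreal (1 - 1/2) * ennreal (\<psi> (norm y))"
    using strict[unfolded strictly_convex_fun_def, rule_format, of "1/2" x y] assms(2) by auto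
  also have "\<dots> = ennreal (\<psi> (norm y))"
    using assms(3) ennreal_weighted_mean[of "1/2"] by simp
  finally show ?thesis using nonneg less_iff by (simp add: ennreal_less_iff)
qed

text \<open>The midpoint of two conjugates of \<open>v\<close> still pairs with \<open>v\<close> to
  \<open>norm v * norm v\<close>, so its norm is at least \<open>norm v\<close>; strict convexity
  would make it smaller.\<close>

lemma duality_map_singleton:
  assumes strict: "strictly_convex_fun (\<lambda>f :: 'a::real_normed_vector \<Rightarrow>\<^sub>L real. ennreal (\<psi> (norm f)))"
  shows "duality_map (v::'a) = {duality_op v}"
proof -
  obtain f where f: "f \<in> duality_map v" using duality_map_nonempty by blast
  have "g = f" if g: "g \<in> duality_map v" for g
  proof (rule ccontr)
    assume "g \<noteq> f"
    let ?h = "(1/2) *\<^sub>R g + (1/2) *\<^sub>R f"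
    have fg: "norm f = norm v" "norm g = norm v" "blinfun_apply f v = norm v * norm v"
      "blinfun_apply g v = norm v * norm v"
      using f g by (auto simp: duality_map_def conjugate_pair_def)
    then have "norm ?h < norm v"
      using strictly_convex_norm_midpoint[OF strict \<open>g \<noteq> f\<close>] by simp
    moreover have "norm v * norm v \<le> norm ?h * norm v"
      using norm_blinfun[of ?h v] fg by (simp add: blinfun.add_left blinfun.scaleR_left)
    moreover have "0 < norm v" using calculation(1) order_le_less_trans[OF norm_ge_zero] by blast
    ultimately show False by simp
  qed
  then have "duality_map v = {f}" using f by blast
  then show ?thesis by (simp add: duality_op_def)
qed

end

section \<open>The representer theorem\<close>

lemma riesz_conjugate_sum:
  assumes ip: "induces_norm ip"
  shows "riesz_conjugate ip (\<Sum>i\<in>I. c i *\<^sub>R v i) = (\<Sum>i\<in>I. c i *\<^sub>R riesz_conjugate ip (v i))"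
proof (rule blinfun_eqI)
  fix w
  have L: "linear (\<lambda>x. ip x w)" using ip by (simp add: induces_norm_def bilinear_def)
  show "blinfun_apply (riesz_conjugate ip (\<Sum>i\<in>I. c i *\<^sub>R v i)) w =
      blinfun_apply (\<Sum>i\<in>I. c i *\<^sub>R riesz_conjugate ip (v i)) w"
    by (simp add: riesz_conjugate_apply[OF ip] blinfun.sum_left blinfun.scaleR_left
        linear_sum[OF L] linear_scale[OF L])
qed

theorem theorem2:
  fixes \<nu> :: "'m::finite \<Rightarrow> 'a::banach"
    and E :: "real ^ 'm \<Rightarrow> real ^ 'm \<Rightarrow> ennreal"
    and \<psi> :: "real \<Rightarrow> real"
    and y :: "real ^ 'm"
  assumes "inj \<nu>" and "independent (range \<nu>)"
    and "\<forall>y'. proper_fun (E y')"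
    and "\<forall>y'. weakly_lsc (E y')"
    and "\<forall>y'. convex_fun (E y')"
    and "\<forall>t\<ge>0. 0 \<le> \<psi> t"
    and "strict_mono_on {0..} \<psi>"
    and "convex_on {0..} \<psi>"
  shows "solution_set \<nu> E \<psi> y \<noteq> {} \<and>
    convex (solution_set \<nu> E \<psi> y) \<and>
    compactin weak_star_topology (solution_set \<nu> E \<psi> y) \<and>
    (\<exists>a :: real ^ 'm. \<exists>\<nu>\<^sub>0. \<nu>\<^sub>0 = (\<Sum>m\<in>UNIV. a $ m *\<^sub>R \<nu> m) \<and> \<nu>\<^sub>0 \<in> span (range \<nu>) \<and>
      ((\<forall>y'. strictly_convex_fun (E y')) \<or> imposes_equality E
        \<longrightarrow> solution_set \<nu> E \<psi> y \<subseteq> duality_map \<nu>\<^sub>0) \<and>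
      (strictly_convex_space TYPE('a) \<and>
       strictly_convex_fun (\<lambda>f :: 'a \<Rightarrow>\<^sub>L real. ennreal (\<psi> (norm f)))
        \<longrightarrow> (\<forall>v::'a. duality_map v = {duality_op v}) \<and>
            solution_set \<nu> E \<psi> y = {duality_op \<nu>\<^sub>0}) \<and>
      (\<forall>ip. induces_norm ip \<and>
       ((\<forall>y'. strictly_convex_fun (E y')) \<or> imposes_equality E \<or>
        strictly_convex_fun (\<lambda>f :: 'a \<Rightarrow>\<^sub>L real. ennreal (\<psi> (norm f))))
        \<longrightarrow> solution_set \<nu> E \<psi> y = {\<Sum>m\<in>UNIV. a $ m *\<^sub>R riesz_conjugate ip (\<nu> m)}))"
proof -
  interpret regularizer \<psi>
    using assms(6-8) by unfold_locales auto
  let ?g = "\<lambda>f :: 'a \<Rightarrow>\<^sub>L real. E y (measurement \<nu> f)"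
  let ?h = "\<lambda>f :: 'a \<Rightarrow>\<^sub>L real. ennreal (\<psi> (norm f))"
  let ?J = "\<lambda>f. ?g f + ?h f"
  define S where "S = solution_set \<nu> E \<psi> y"
  have S: "S = {f. is_arg_min ?J (\<lambda>_. True) f}" by (simp add: S_def solution_set_def)
  have convex_g: "convex_fun ?g"
    by (rule convex_fun_compose_linear[OF linear_measurement assms(5)[rule_format]])
  have closed: "closedin weak_star_topology {f. ?J f \<le> c}" for c
    by (rule closedin_sublevel_add[OF strong_operator_topology_topspace
          closedin_measurement_sublevel[OF assms(4)[rule_format]] closedin_norm_sublevel])
  \<comment> \<open>Properness gives data of finite loss, and independence of the
    \<open>\<nu> m\<close> lets a functional realize them. The objective is thus finite somewhere,
    which yields a norm-bounded sublevel set.\<close>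
  obtain z\<^sub>0 where z\<^sub>0: "E y z\<^sub>0 < \<infinity>" using assms(3) by (auto simp: proper_fun_def)
  obtain f\<^sub>0 where "measurement \<nu> f\<^sub>0 = z\<^sub>0"
    using minimal_norm_interpolant[OF assms(1,2), of z\<^sub>0] by metis
  with z\<^sub>0 have Jf\<^sub>0: "?J f\<^sub>0 < \<infinity>" by simp
  then obtain r where r: "?J f\<^sub>0 = ennreal r" "r \<ge> 0"
    by (cases "?J f\<^sub>0") auto
  obtain R where R: "\<And>t. t \<ge> 0 \<Longrightarrow> \<psi> t \<le> r \<Longrightarrow> t \<le> R" using coercive[of r] by blast
  have "norm f \<le> R" if "?J f \<le> ?J f\<^sub>0" for f
  proof -
    have "?h f \<le> ?J f" by simp
    then have "?h f \<le> ennreal r" using that r by (metis order_trans)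
    then show ?thesis using R[of "norm f"] r by (simp add: ennreal_le_iff)
  qed
  then have "{f. ?J f \<le> ?J f\<^sub>0} \<subseteq> {f. norm f \<le> R}" by blast
  with Banach_Alaoglu have compact: "compactin weak_star_topology {f. ?J f \<le> ?J f\<^sub>0}"
    using closed by (rule closed_compactin)
  have nonempty: "S \<noteq> {}" and compact_S: "compactin weak_star_topology S"
    unfolding S using compactin_arg_min[of weak_star_topology ?J f\<^sub>0, OF closed compact] by auto
  have convex_S: "convex S"
    unfolding S by (intro convex_arg_min convex_fun_add convex_g convex_fun_norm)
  have finite: "?J f < \<infinity>" if "f \<in> S" for f
  proof -
    have "?J f \<le> ?J f\<^sub>0" using that by (auto simp: S is_arg_min_linorder)
    then show ?thesis using Jf\<^sub>0 by (rule order_le_less_trans)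
  qed

  \<comment> \<open>The weights come from the measurements of a single solution, before any
    strictness is assumed, so that one \<open>a\<close> serves every conclusion.\<close>
  obtain f\<^sub>1 where f\<^sub>1: "f\<^sub>1 \<in> S" using nonempty by blast
  obtain a :: "real ^ 'm" and f where f: "measurement \<nu> f = measurement \<nu> f\<^sub>1"
    and dual: "\<And>g. measurement \<nu> g = measurement \<nu> f\<^sub>1 \<Longrightarrow> norm g \<le> norm f \<Longrightarrow>
      g \<in> duality_map (\<Sum>m\<in>UNIV. a $ m *\<^sub>R \<nu> m)"
    using minimal_norm_interpolant[OF assms(1,2), of "measurement \<nu> f\<^sub>1"] by metis
  define \<nu>\<^sub>0 where "\<nu>\<^sub>0 = (\<Sum>m\<in>UNIV. a $ m *\<^sub>R \<nu> m)"
  have S_dual: "g \<in> duality_map \<nu>\<^sub>0" if g: "g \<in> S" "measurement \<nu> g = measurement \<nu> f\<^sub>1" for g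
  proof -
    have "?J g \<le> ?J f" using g(1) by (auto simp: S is_arg_min_linorder)
    moreover have "?g g < \<infinity>" using finite[OF g(1)] by simp
    \<comment> \<open>\<open>g\<close> and \<open>f\<close> have equal measurements, so the finite
      data term cancels and only the norms are compared.\<close>
    ultimately have "?h g \<le> ?h f" using g(2) f by (auto simp: ennreal_add_left_cancel_le)
    then have "norm g \<le> norm f" using nonneg[of "norm f"] le_iff by (simp add: ennreal_le_iff)
    with g(2) show ?thesis unfolding \<nu>\<^sub>0_def by (rule dual)
  qed

  have dual1: "S \<subseteq> duality_map \<nu>\<^sub>0" if "(\<forall>y'. strictly_convex_fun (E y')) \<or> imposes_equality E"
  proof
    fix g assume g: "g \<in> S"
    have fin: "?g f\<^sub>1 < \<infinity>" "?g g < \<infinity>" using finite[OF f\<^sub>1] finite[OF g] by auto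
    from that have "measurement \<nu> g = measurement \<nu> f\<^sub>1"
    proof
      assume "\<forall>y'. strictly_convex_fun (E y')"
      then have strict: "strictly_convex_fun (E y)" by blast
      show ?thesis
      proof (rule ccontr)
        assume "measurement \<nu> g \<noteq> measurement \<nu> f\<^sub>1"
        \<comment> \<open>Different measurements would make the loss drop strictly at the midpoint,
          while the regularizer stays convex.\<close>
        with strict fin have "?g ((1/2) *\<^sub>R g + (1 - 1/2) *\<^sub>R f\<^sub>1) < ennreal (1/2) * ?g g + ennreal (1 - 1/2) * ?g f\<^sub>1"
          unfolding linear_add[OF linear_measurement] linear_scale[OF linear_measurement]
          by (intro strict[unfolded strictly_convex_fun_def, rule_format]) auto
        moreover have "?h ((1/2) *\<^sub>R g + (1 - 1/2) *\<^sub>R f\<^sub>1) \<le> ennreal (1/2) * ?h g + ennreal (1 - 1/2) * ?h f\<^sub>1"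
          by (intro convex_fun_norm[unfolded convex_fun_def, rule_format]) auto
        ultimately show False
          using arg_min_no_strict_decrease[of ?g ?h g f\<^sub>1 "1/2"] g f\<^sub>1 finite[OF g] by (auto simp: S)
      qed
    next
      assume eq: "imposes_equality E"
      \<comment> \<open>Finite loss forces the measurements of both solutions to equal
        \<open>y\<close>.\<close>
      have "y = z" if "E y z < \<infinity>" for z
        using eq that unfolding imposes_equality_def by (metis less_irrefl)
      then show ?thesis using fin by metis
    qed
    with g show "g \<in> duality_map \<nu>\<^sub>0" by (rule S_dual)
  qed
  \<comment> \<open>Here the roles are exchanged: the regularizer drops strictly and the loss is
    convex, so all solutions coincide with \<open>f\<^sub>1\<close>.\<close>
  have dual2: "S \<subseteq> duality_map \<nu>\<^sub>0" if strict: "strictly_convex_fun ?h"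
  proof
    fix g assume g: "g \<in> S"
    have "g = f\<^sub>1"
    proof (rule ccontr)
      assume "g \<noteq> f\<^sub>1"
      then have "?h ((1/2) *\<^sub>R g + (1 - 1/2) *\<^sub>R f\<^sub>1) < ennreal (1/2) * ?h g + ennreal (1 - 1/2) * ?h f\<^sub>1"
        by (intro strict[unfolded strictly_convex_fun_def, rule_format]) auto
      moreover have "?g ((1/2) *\<^sub>R g + (1 - 1/2) *\<^sub>R f\<^sub>1) \<le> ennreal (1/2) * ?g g + ennreal (1 - 1/2) * ?g f\<^sub>1"
        by (intro convex_g[unfolded convex_fun_def, rule_format]) auto
      ultimately show False
        using arg_min_no_strict_decrease[of ?h ?g g f\<^sub>1 "1/2"] g f\<^sub>1 finite[OF g]
        by (simp add: S add.commute)
    qed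
    with g show "g \<in> duality_map \<nu>\<^sub>0" by (intro S_dual) auto
  qed

  have "\<nu>\<^sub>0 \<in> span (range \<nu>)"
    unfolding \<nu>\<^sub>0_def by (intro span_sum span_scale span_base) auto
  \<comment> \<open>A nonempty subset of a singleton is that singleton; the Hilbert case below ends
    the same way.\<close>
  moreover have "(\<forall>v::'a. duality_map v = {duality_op v}) \<and> S = {duality_op \<nu>\<^sub>0}" if "strictly_convex_fun ?h"
    using duality_map_singleton[OF that] dual2[OF that] nonempty by auto
  moreover have "S = {\<Sum>m\<in>UNIV. a $ m *\<^sub>R riesz_conjugate ip (\<nu> m)}"
    if "induces_norm ip" "(\<forall>y'. strictly_convex_fun (E y')) \<or> imposes_equality E \<or> strictly_convex_fun ?h" for ip
  proof -
    have "S \<subseteq> duality_map \<nu>\<^sub>0" using that(2) dual1 dual2 by blast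
    also have "duality_map \<nu>\<^sub>0 = {\<Sum>m\<in>UNIV. a $ m *\<^sub>R riesz_conjugate ip (\<nu> m)}"
      by (simp add: duality_map_Hilbert[OF that(1)] \<nu>\<^sub>0_def riesz_conjugate_sum[OF that(1)])
    finally show ?thesis using nonempty by blast
  qed
  ultimately show ?thesis
    unfolding S_def[symmetric] using nonempty convex_S compact_S dual1 \<nu>\<^sub>0_def by blast
qed

end
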